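(* For every $n\ge 1$, the map $\Phi$ (defined in the context) is well defined, i.e. for every snake $\pi$ of type $B_n$ the pair $\Phi(\pi)=(P;W)$ is a labeled ballot path of length $n$, and $\Phi$ is a bijection from the set of snakes of type $B_n$ onto the set of labeled ballot paths of length $n$.
   Context: A signed permutation of $[n]=\{1,\dots,n\}$ is a word $\pi=\pi_1\cdots\pi_n$ obtained from a permutation of $[n]$ by giving some entries a minus sign; $-i$ is written $\bar i$. Signed entries are compared in the order $\bar n<\cdots<\bar 1<1<\cdots<n$. A snake of type $B_n$ is a signed permutation with $0<\pi_1>\pi_2<\pi_3>\pi_4<\cdots\pi_n$ (alternating relations throughout). A ballot path of length $n$ is a lattice path from $(0,0)$ with $n$ steps, each an up step $u=(1,1)$ or a down step $d=(1,-1)$, never going below the $x$-axis. The height of a step is the smaller of the $y$-coordinates of its two endpoints. A labeled ballot path $(P;W)$, $P=p_1\cdots p_n$, $W=w_1\cdots w_n$, is a ballot path in which each step $p_i$ carries an integer label $w_i$ with $0\le w_i\le$ height of $p_i$. Inversion code: for a snake $\pi$ of type $B_n$ and $1\le i\le n$, if $n$ is odd let $c_i(\pi)$ be the number of $k$ with $1\le k\le (n-1)/2$, $i<2k$ and $\pi_{2k}<\pi_i<\pi_{2k+1}$; if $n$ is even let $c_i(\pi)$ be the number of $k$ with $1\le k\le n/2$, $i<2k-1$ and $\pi_{2k}<\pi_i<\pi_{2k-1}$. The map $\Phi$: given a snake $\pi$ of type $B_n$, define $p_1,\dots,p_n$ and $w_1,\dots,w_n$ successively for $k=1,\dots,n$: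 let $i$ be the position with $\pi_i\in\{n-k+1,\overline{n-k+1}\}$. If $\pi_i=n-k+1$, set $p_k=u$ if $i$ is odd and $p_k=d$ if $i$ is even, and set $w_k=c_i(\pi)$. If $\pi_i=\overline{n-k+1}$, set $p_k=d$ if $i$ is odd and $p_k=u$ if $i$ is even, and set $w_k=h_k-c_i(\pi)$, where $h_k$ is the height of the $k$-th step in the path $p_1\cdots p_k$. Then $\Phi(\pi)=(p_1\cdots p_n;w_1\cdots w_n)$. *)

theory Defs
  imports Main
begin

(* Signed permutations of [n] are int lists; entry -i encodes \bar i.
   The order \bar n < ... < \bar 1 < 1 < ... < n is the usual order on int.
   Positions are 1-indexed: ent pi i = pi_i = pi ! (i-1). *)

definition ent :: "int list \<Rightarrow> nat \<Rightarrow> int" where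
  "ent \<pi> i = \<pi> ! (i - 1)"

definition signed_perm :: "nat \<Rightarrow> int list \<Rightarrow> bool" where
  "signed_perm n \<pi> \<longleftrightarrow> length \<pi> = n \<and> distinct (map abs \<pi>) \<and> set (map abs \<pi>) = {1..int n}"

definition snake :: "nat \<Rightarrow> int list \<Rightarrow> bool" where
  "snake n \<pi> \<longleftrightarrow> signed_perm n \<pi> \<and> (n \<ge> 1 \<longrightarrow> 0 < ent \<pi> 1) \<and>
     (\<forall>i. 1 \<le> i \<and> i < n \<longrightarrow>
        (if odd i then ent \<pi> i > ent \<pi> (i+1) else ent \<pi> i < ent \<pi> (i+1)))"

(* Paths: True = up step u, False = down step d. ypos P k = y-coordinate after k steps. *)
definition ypos :: "bool list \<Rightarrow> nat \<Rightarrow> int" where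
  "ypos P k = (\<Sum>j<k. if P ! j then 1 else -1)"

(* height of the k-th step (1-indexed) *)
definition height :: "bool list \<Rightarrow> nat \<Rightarrow> int" where
  "height P k = min (ypos P (k - 1)) (ypos P k)"

definition ballot_path :: "nat \<Rightarrow> bool list \<Rightarrow> bool" where
  "ballot_path n P \<longleftrightarrow> length P = n \<and> (\<forall>k\<le>n. 0 \<le> ypos P k)"

definition labeled_ballot_path :: "nat \<Rightarrow> bool list \<times> int list \<Rightarrow> bool" where
  "labeled_ballot_path n PW \<longleftrightarrow> (case PW of (P, W) \<Rightarrow>
     ballot_path n P \<and> length W = n \<and>
     (\<forall>k\<in>{1..n}. 0 \<le> W ! (k - 1) \<and> W ! (k - 1) \<le> height P k))"

definition inv_code :: "nat \<Rightarrow> int list \<Rightarrow> nat \<Rightarrow> nat" where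
  "inv_code n \<pi> i =
     (if odd n then card {k. 1 \<le> k \<and> k \<le> (n - 1) div 2 \<and> i < 2*k \<and>
                            ent \<pi> (2*k) < ent \<pi> i \<and> ent \<pi> i < ent \<pi> (2*k+1)}
      else card {k. 1 \<le> k \<and> k \<le> n div 2 \<and> i < 2*k - 1 \<and>
                            ent \<pi> (2*k) < ent \<pi> i \<and> ent \<pi> i < ent \<pi> (2*k - 1)})"

definition posn :: "int list \<Rightarrow> int \<Rightarrow> nat" where
  "posn \<pi> v = (THE i. 1 \<le> i \<and> i \<le> length \<pi> \<and> \<bar>ent \<pi> i\<bar> = v)"

definition Phi_path :: "nat \<Rightarrow> int list \<Rightarrow> bool list" where
  "Phi_path n \<pi> = map (\<lambda>k. let i = posn \<pi> (int (n - k + 1)) in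
                          (if 0 < ent \<pi> i then odd i else even i)) [1..<n+1]"

(* h_k is the height of the k-th step of p_1...p_k, equal to its height in the full path *)
definition Phi :: "nat \<Rightarrow> int list \<Rightarrow> bool list \<times> int list" where
  "Phi n \<pi> = (let P = Phi_path n \<pi> in
     (P, map (\<lambda>k. let i = posn \<pi> (int (n - k + 1)) in
                 (if 0 < ent \<pi> i then int (inv_code n \<pi> i)
                  else height (take k P) k - int (inv_code n \<pi> i))) [1..<n+1]))"

end

theory Submission
  imports Defs "HOL-Library.Multiset"
begin

text \<open>
  Process the absolute values of a snake in the order \<open>n, n - 1, \<dots>, 1\<close>. Once the values above \<open>v\<close>
  have been read, collapse every maximal run of consecutive entries of the same sign and of absolute
  value above \<open>v\<close> to a single limit entry \<open>\<plusminus>M\<close>, where \<open>M > n\<close>, with an additional limit entry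
  placed after \<open>\<pi>\<^sub>n\<close> (positive iff \<open>n\<close> is even). All runs have odd length, so the collapsed word is
  again alternating, and the current height of the path is one less than its number of limit entries.
  An up step is a single entry turning into a new limit entry, a down step merges the two limit
  entries of equal sign around an entry.

  Going backwards, a word with \<open>t\<close> limit entries is expanded by replacing one of them, except the
  additional one, by \<open>\<plusminus>v\<close> (up step), or by splitting one of them around \<open>\<plusminus>v\<close> (down step). Rank the
  limit entries: the positive ones from right to left, then the negative ones from left to right.
  The label of the step is exactly the rank of the chosen entry, lowered by one for up steps if \<open>n\<close>
  is even, since then the additional entry has rank 0. Hence labels within the height of the step
  correspond bijectively to the possible expansions, and the theorem follows by induction on \<open>v\<close>.

  All words are stored reversed, so that the additional limit entry comes first and the inversion
  code of an entry only depends on the part of the list before it.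
\<close>

section \<open>Alternating words\<close>

definition hd0 :: "int list \<Rightarrow> int" where
  "hd0 xs = (case xs of [] \<Rightarrow> 0 | x # _ \<Rightarrow> x)"

lemma hd0_simps [simp]: "hd0 [] = 0" "hd0 (x # xs) = x"
  by (simp_all add: hd0_def)

lemma hd0_in: "hd0 xs \<in> insert 0 (set xs)"
  by (cases xs) auto

text \<open>The flag tells whether the first element is a peak; a virtual final valley 0 encodes
  \<open>0 < \<pi>\<^sub>1\<close>.\<close>

fun alternating :: "bool \<Rightarrow> int list \<Rightarrow> bool" where
  "alternating e [] \<longleftrightarrow> \<not> e"
| "alternating e (x # xs) \<longleftrightarrow>
     (if e then hd0 xs < x else x < hd0 xs) \<and> alternating (\<not> e) xs"

text \<open>Peaks and valleys alternate from the flag \<open>e\<close> on, so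
  \<open>e = even (length A)\<close> says that the entry after \<open>A\<close> is a peak; this test
  recurs below.\<close>

lemma alternating_next:
  "alternating e (A @ x # B) \<Longrightarrow>
     (if e = even (length A) then hd0 B < x else x < hd0 B)"
  by (induction A arbitrary: e) (auto split: if_splits)

lemma hd0_append: "hd0 (A @ x # B) = (if A = [] then x else hd A)"
  by (cases A) auto

text \<open>The condition runs over all other entries, not just the neighbours, because later it
  follows from the range of values alone; 0 is the virtual valley, met when
  \<open>B = []\<close>.\<close>

lemma alternating_replace:
  assumes "alternating e (A @ x # B)"
    and "\<And>z. z \<in> insert 0 (set A \<union> set B) \<Longrightarrow>
      (if e = even (length A) then z < x \<longrightarrow> z < y else x < z \<longrightarrow> y < z)"
  shows "alternating e (A @ y # B)"
  using assms
proof (induction A arbitrary: e)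
  case Nil
  then show ?case using hd0_in[of B] by (auto split: if_splits)
next
  case (Cons a A)
  have "alternating (\<not> e) (A @ y # B)"
  proof (rule Cons.IH)
    show "alternating (\<not> e) (A @ x # B)" using Cons.prems(1) by simp
    show "if (\<not> e) = even (length A) then z < x \<longrightarrow> z < y else x < z \<longrightarrow> y < z"
      if "z \<in> insert 0 (set A \<union> set B)" for z
      using Cons.prems(2)[of z] that by (cases e; cases "even (length A)"; auto)
  qed
  moreover have "if e then hd0 (A @ y # B) < a else a < hd0 (A @ y # B)"
    using Cons.prems(1) Cons.prems(2)[of a]
    by (auto simp: hd0_append split: if_splits)
  ultimately show ?case by simp
qed

text \<open>Two inserted entries keep the parity of every position in \<open>B\<close>, and the
  outer neighbours still meet \<open>T\<close>; only the comparison of \<open>x\<close> with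
  \<open>T\<close> is new.\<close>

lemma alternating_triple:
  "alternating e (A @ T # x # T # B) \<longleftrightarrow>
     alternating e (A @ T # B) \<and> (if e = even (length A) then x < T else T < x)"
  by (induction A arbitrary: e) (auto simp: hd0_append)

lemma alternating_nth:
  "alternating e xs \<longleftrightarrow> e = odd (length xs) \<and>
     (\<forall>i<length xs. if e = even i then (xs @ [0]) ! Suc i < xs ! i else xs ! i < (xs @ [0]) ! Suc i)"
proof (induction xs arbitrary: e)
  case (Cons x xs)
  have "(xs @ [0]) ! 0 = hd0 xs" by (cases xs) auto
  then show ?case
    by (cases e; simp add: Cons.IH All_less_Suc2; blast)
qed simp

fun limit_word :: "int \<Rightarrow> bool \<Rightarrow> nat \<Rightarrow> int list" where
  "limit_word M e 0 = []"
| "limit_word M e (Suc t) = (if e then M else - M) # limit_word M (\<not> e) t"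

lemma alternating_limit_word:
  "0 < M \<Longrightarrow> e = odd t \<Longrightarrow> alternating e (limit_word M e t)"
proof (induction t arbitrary: e)
  case (Suc t)
  then show ?case by (cases t) auto
qed simp

lemma abs_limit_word: "0 < M \<Longrightarrow> map abs (limit_word M e t) = replicate t M"
  by (induction t arbitrary: e) auto

text \<open>The signs are forced: \<open>- M\<close> cannot be a peak and \<open>M\<close> cannot be
  a valley, since no entry lies beyond them.\<close>

lemma alternating_extremal_unique:
  assumes "0 < M" "alternating e xs" "\<forall>z\<in>set xs. \<bar>z\<bar> = M"
  shows "xs = limit_word M e (length xs)"
  using assms(2,3)
proof (induction xs arbitrary: e)
  case (Cons x xs)
  then have "xs = limit_word M (\<not> e) (length xs)" by auto
  moreover have "\<bar>hd0 xs\<bar> \<le> M" using Cons.prems \<open>0 < M\<close> hd0_in[of xs] by auto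
  then have "x = (if e then M else - M)"
    using Cons.prems by (auto split: if_splits)
  ultimately show ?case by simp
qed simp

section \<open>Counting crossings\<close>

text \<open>Works on disjoint consecutive pairs and ignores a last unpaired element. With the bits
  \<open>x < z\<close>, an unequal pair is a pair of entries enclosing \<open>x\<close>, as counted
  by the inversion code.\<close>

fun changes :: "bool list \<Rightarrow> nat" where
  "changes (a # b # r) = (if a = b then 0 else 1) + changes r"
| "changes _ = 0"

lemma changes_Not: "changes (map Not D) = changes D"
  by (induction D rule: changes.induct) auto

text \<open>For either parity of \<open>length A\<close>, two of the three equal bits form a pair of
  their own and the other pairs stay as they are.\<close>

lemma changes_triple: "changes (A @ b # b # b # B) = changes (A @ b # B)"
  by (induction A rule: changes.induct) auto

lemma changes_snoc: "even (length D) \<Longrightarrow> changes (D @ [b]) = changes D"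
  by (induction D rule: changes.induct) auto

lemma changes_card:
  "changes D = card {l. 2 * l + 1 < length D \<and> D ! (2 * l) \<noteq> D ! (2 * l + 1)}"
proof (induction D rule: changes.induct)
  case (1 a b r)
  let ?S = "\<lambda>D. {l. 2 * l + 1 < length D \<and> D ! (2 * l) \<noteq> D ! (2 * l + 1)}"
  have fin: "finite (?S r)" by (rule finite_subset[of _ "{..<length r}"]) auto
  have "?S (a # b # r) = (if a = b then {} else {0}) \<union> Suc ` ?S r"
  proof (intro set_eqI)
    fix l show "l \<in> ?S (a # b # r) \<longleftrightarrow> l \<in> (if a = b then {} else {0}) \<union> Suc ` ?S r"
      by (cases l) auto
  qed
  moreover have "card ((if a = b then {} else {0}) \<union> Suc ` ?S r)
      = (if a = b then 0 else 1) + card (?S r)"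
    using fin by (auto simp: card_image)
  ultimately show ?case using 1 by simp
qed auto

text \<open>Models the places of one limit entry: its copies are all peaks or all valleys, hence at
  positions of one parity.\<close>

fun marked_at :: "bool \<Rightarrow> bool list \<Rightarrow> bool" where
  "marked_at g [] = True"
| "marked_at g (b # D) = ((b \<longrightarrow> g) \<and> marked_at (\<not> g) D)"

text \<open>A pair contains at most one \<open>True\<close>, so it is unequal exactly when it
  contains one; the parity condition excludes an unpaired \<open>True\<close> at the end.\<close>

lemma changes_marked:
  "marked_at g D \<Longrightarrow> even (length D) \<or> \<not> g \<Longrightarrow> changes D = count_list D True"
  by (induction D rule: changes.induct) auto

lemma marked_at_snoc:
  "marked_at g (D @ [b]) \<longleftrightarrow> marked_at g D \<and> (b \<longrightarrow> g = even (length D))"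
  by (induction D arbitrary: g) auto

text \<open>For up steps: the dropped head is the additional limit entry, which is marked exactly if
  \<open>g\<close>; all other marks are paired.\<close>

lemma changes_tl:
  assumes "marked_at g D" "D \<noteq> []" "hd D = g" "g = even (length D)"
  shows "int (changes (tl D)) = int (count_list D True) - (if g then 1 else 0)"
proof -
  from assms obtain D' where D: "D = g # D'" by (cases D) auto
  then have "changes D' = count_list D' True"
    using assms by (intro changes_marked[of "\<not> g"]) auto
  then show ?thesis using D by auto
qed

text \<open>For down steps: the prefix ends in one more marked entry. If \<open>g\<close>, it makes
  up for the dropped marked head (or is itself dropped, if \<open>D = []\<close>); otherwise it
  stays unpaired and the dropped head is unmarked.\<close>

lemma changes_tl_snoc:
  assumes "marked_at g D" "D \<noteq> [] \<Longrightarrow> hd D = g" "g = even (length D)"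
  shows "changes (tl (D @ [True])) = count_list D True"
proof (cases D)
  case (Cons a D')
  have a: "a = g" using assms(2) Cons by simp
  have m: "marked_at (\<not> g) D'" using assms(1) Cons by simp
  have par: "odd (length D') = g" using assms(3) Cons by simp
  show ?thesis
  proof (cases g)
    case True
    have "changes (D' @ [True]) = count_list (D' @ [True]) True"
      using m par True by (intro changes_marked[of False]) (auto simp: marked_at_snoc)
    then show ?thesis using Cons a True by simp
  next
    case False
    then have "changes (D' @ [True]) = changes D'"
      using par by (intro changes_snoc) auto
    also have "changes D' = count_list D' True"
      using m par False by (intro changes_marked[of True]) auto
    finally show ?thesis using Cons a False by simp
  qed
qed simp

lemma count_list_map_eq: "count_list (map (\<lambda>z. z = T) A) True = count_list A T"
  by (induction A) auto

lemma count_list_split: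
  "r < count_list xs y \<Longrightarrow> \<exists>A B. xs = A @ y # B \<and> count_list A y = r"
proof (induction xs arbitrary: r)
  case (Cons x xs)
  show ?case
  proof (cases "x = y")
    case True
    show ?thesis
    proof (cases r)
      case 0
      then show ?thesis using True by (intro exI[of _ "[]"] exI[of _ xs]) auto
    next
      case (Suc r')
      then obtain A B where "xs = A @ y # B" "count_list A y = r'"
        using Cons.IH[of r'] Cons.prems True by auto
      then show ?thesis using True Suc
        by (intro exI[of _ "x # A"] exI[of _ B]) auto
    qed
  next
    case False
    then obtain A B where "xs = A @ y # B" "count_list A y = r"
      using Cons.IH[of r] Cons.prems by auto
    then show ?thesis using False by (intro exI[of _ "x # A"] exI[of _ B]) auto
  qed
qed simp

lemma count_list_split_unique:
  "A @ y # B = A' @ y # B' \<Longrightarrow> count_list A y = count_list A' y \<Longrightarrow> A = A' \<and> B = B'"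
proof (induction A arbitrary: A')
  case Nil
  then show ?case by (cases A') auto
next
  case (Cons a A)
  then show ?case by (cases A') (auto split: if_splits)
qed

lemma count_abs:
  "0 < (M::int) \<Longrightarrow> count (mset (map abs xs)) M = count_list xs M + count_list xs (- M)"
  by (induction xs) auto

section \<open>Words with limit entries\<close>

text \<open>The word left once the values above \<open>v\<close> are collapsed. Its head is the
  additional limit entry, whose sign no step changes, so \<open>e\<close> stays fixed
  throughout.\<close>

definition word_state :: "int \<Rightarrow> bool \<Rightarrow> nat \<Rightarrow> nat \<Rightarrow> int list \<Rightarrow> bool" where
  "word_state M e v t s \<longleftrightarrow>
     mset (map abs s) = mset_set {1..int v} + replicate_mset t M \<and>
     alternating e s \<and> s \<noteq> [] \<and> \<bar>hd s\<bar> = M"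

lemma word_state_abs:
  assumes "word_state M e v t s" "z \<in> set s"
  shows "\<bar>z\<bar> = M \<or> 1 \<le> \<bar>z\<bar> \<and> \<bar>z\<bar> \<le> int v"
proof -
  have "\<bar>z\<bar> \<in># mset (map abs s)" using assms(2) by simp
  then have "\<bar>z\<bar> \<in># mset_set {1..int v} + replicate_mset t M"
    using assms(1) unfolding word_state_def by metis
  then show ?thesis by (auto split: if_splits)
qed

lemma word_state_count:
  assumes "word_state M e v t s" "int v < M"
  shows "count_list s M + count_list s (- M) = t"
proof -
  have "count (mset (map abs s)) M = t"
    using assms unfolding word_state_def by simp
  then show ?thesis using count_abs[of M s] assms(2) by simp
qed

text \<open>No entry exceeds a limit entry in absolute value, so a limit entry is a peak exactly
  when it is positive.\<close>

lemma limit_entry_parity: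
  assumes "word_state M e v t (A @ T # B)" "\<bar>T\<bar> = M" "int v < M"
  shows "(e = (0 < T)) = even (length A)"
proof -
  have "\<bar>hd0 B\<bar> \<le> M"
    using word_state_abs[OF assms(1), of "hd0 B"] hd0_in[of B] assms(3) by auto
  moreover have "if e = even (length A) then hd0 B < T else T < hd0 B"
    using assms(1) alternating_next unfolding word_state_def by blast
  ultimately show ?thesis using assms(2) by (auto split: if_splits)
qed

lemma word_state_hd:
  assumes "word_state M e v t s" "int v < M"
  shows "hd s = (if e then M else - M)"
proof -
  obtain x r where s: "s = x # r" "\<bar>x\<bar> = M"
    using assms(1) unfolding word_state_def by (cases s) auto
  then have "e = (0 < x)"
    using limit_entry_parity[of M e v t "[]" x r] assms by simp
  then show ?thesis using s assms(2) by auto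
qed

lemma marked_at_limit:
  assumes "alternating e (A @ R)" "\<forall>z\<in>set (A @ R). \<bar>z\<bar> \<le> M" "\<bar>T\<bar> = M" "0 < M"
  shows "marked_at (e = (0 < T)) (map (\<lambda>z. z = T) A)"
  using assms(1,2)
proof (induction A arbitrary: e)
  case (Cons a A)
  have "\<bar>hd0 (A @ R)\<bar> \<le> M" using Cons.prems(2) hd0_in[of "A @ R"] \<open>0 < M\<close> by auto
  then have "a = T \<Longrightarrow> e = (0 < T)"
    using Cons.prems(1) assms(3) by (auto split: if_splits)
  moreover have "marked_at ((\<not> e) = (0 < T)) (map (\<lambda>z. z = T) A)"
    using Cons.prems by (intro Cons.IH) auto
  moreover have "((\<not> e) = (0 < T)) = (\<not> (e = (0 < T)))" by auto
  ultimately show ?case by simp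
qed simp

section \<open>Collapsing and expanding\<close>

definition before :: "int \<Rightarrow> int list \<Rightarrow> int list" where
  "before x s = takeWhile (\<lambda>z. z \<noteq> x) s"

text \<open>The tail drops the additional limit entry; the remaining entries are paired as in the
  definition of the inversion code, for either parity of \<open>n\<close>.\<close>

definition crossing_code :: "int \<Rightarrow> int list \<Rightarrow> nat" where
  "crossing_code x s = changes (map (\<lambda>z. x < z) (tl (before x s)))"

text \<open>An up step comes from a positive peak or a negative valley. This parity test survives
  collapsing because runs have odd length.\<close>

definition upward :: "bool \<Rightarrow> int \<Rightarrow> int list \<Rightarrow> bool" where
  "upward e x s \<longleftrightarrow> (0 < x) = (even (length (before x s)) = e)"

definition signed_entry :: "int \<Rightarrow> int list \<Rightarrow> int" where
  "signed_entry k s = (if k \<in> set s then k else - k)"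

text \<open>All steps are read off the same uncollapsed word \<open>s\<close>; \<open>y\<close> is
  the height before a step and \<open>min y y'\<close> the height of the step.\<close>

fun encode :: "bool \<Rightarrow> int \<Rightarrow> nat \<Rightarrow> int list \<Rightarrow> (bool \<times> int) list" where
  "encode e y 0 s = []"
| "encode e y (Suc v) s =
     (let x = signed_entry (int (Suc v)) s; p = upward e x s; y' = (if p then y + 1 else y - 1)
      in (p, if 0 < x then int (crossing_code x s) else min y y' - int (crossing_code x s)) # encode e y' v s)"

text \<open>From the front of the reversed word, positive limit entries get 0, 1, ... and negative
  ones \<open>t - 1\<close>, \<open>t - 2\<close>, ...; if there are \<open>t\<close> in all, each
  rank below \<open>t\<close> occurs once.\<close>

definition rank :: "nat \<Rightarrow> int list \<Rightarrow> int \<Rightarrow> int" where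
  "rank t A T = (if 0 < T then int (count_list A T) else int t - 1 - int (count_list A T))"

text \<open>In \<open>expand M e v t s' p w s\<close>, the word \<open>s'\<close> with \<open>t\<close> limit entries is expanded by the value
  \<open>v + 1\<close> to \<open>s\<close>; the condition \<open>A \<noteq> []\<close> protects the additional limit entry.\<close>

inductive expand :: "int \<Rightarrow> bool \<Rightarrow> nat \<Rightarrow> nat \<Rightarrow> int list \<Rightarrow> bool \<Rightarrow> int \<Rightarrow> int list \<Rightarrow> bool"
  for M e v t where
  up: "\<bar>T\<bar> = M \<Longrightarrow> A \<noteq> [] \<Longrightarrow>
    expand M e v t (A @ T # B) True (rank t A T - (if e then 1 else 0))
      (A @ (sgn T * int (Suc v)) # B)"
| down: "\<bar>T\<bar> = M \<Longrightarrow>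
    expand M e v t (A @ T # B) False (rank t A T) (A @ T # (sgn T * int (Suc v)) # T # B)"

section \<open>Expansion and its inverse on words\<close>

lemma atLeastAtMost_Suc_int: "{1..int (Suc v)} = insert (int (Suc v)) {1..int v}"
  by auto

text \<open>Forwards, the other entries are limit entries or at most \<open>v\<close> in absolute
  value, so none separates \<open>x\<close> from \<open>T\<close>; backwards, \<open>T\<close> is
  more extreme than \<open>x\<close>.\<close>

lemma word_state_up_iff:
  assumes "int (Suc v) < M" "A \<noteq> []" "\<bar>T\<bar> = M" "x = sgn T * int (Suc v)"
    "(e = (0 < T)) = even (length A)"
  shows "word_state M e v (Suc t) (A @ T # B) \<longleftrightarrow> word_state M e (Suc v) t (A @ x # B)"
proof -
  have absx: "\<bar>x\<bar> = int (Suc v)" and T0: "T \<noteq> 0"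
    using assms by (auto simp: abs_mult)
  have m: "mset (map abs (A @ T # B)) = mset_set {1..int v} + replicate_mset (Suc t) M \<longleftrightarrow>
    mset (map abs (A @ x # B)) = mset_set {1..int (Suc v)} + replicate_mset t M"
    using assms(3) absx unfolding atLeastAtMost_Suc_int by simp
  have hd: "\<bar>hd (A @ T # B)\<bar> = \<bar>hd (A @ x # B)\<bar>" using assms(2) by simp
  show ?thesis
  proof
    assume st: "word_state M e v (Suc t) (A @ T # B)"
    have "alternating e (A @ x # B)"
    proof (rule alternating_replace)
      show "alternating e (A @ T # B)" using st by (simp add: word_state_def)
      fix z assume z: "z \<in> insert 0 (set A \<union> set B)"
      then have "\<bar>z\<bar> = M \<or> \<bar>z\<bar> \<le> int v" using word_state_abs[OF st, of z] by auto
      then show "if e = even (length A) then z < T \<longrightarrow> z < x else T < z \<longrightarrow> x < z"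
        using assms(1,3,4,5) by (cases "0 < T") (auto simp: sgn_if)
    qed
    then show "word_state M e (Suc v) t (A @ x # B)"
      using st m hd by (simp add: word_state_def)
  next
    assume st: "word_state M e (Suc v) t (A @ x # B)"
    have "alternating e (A @ T # B)"
    proof (rule alternating_replace)
      show "alternating e (A @ x # B)" using st by (simp add: word_state_def)
      show "if e = even (length A) then z < x \<longrightarrow> z < T else x < z \<longrightarrow> T < z" for z
        using assms(1,3,4,5) by (cases "0 < T") (auto simp: sgn_if)
    qed
    then show "word_state M e v (Suc t) (A @ T # B)"
      using st m hd by (simp add: word_state_def)
  qed
qed

lemma word_state_down_iff:
  assumes "int (Suc v) < M" "\<bar>T\<bar> = M" "x = sgn T * int (Suc v)"
    "(e = (0 < T)) = even (length A)"
  shows "word_state M e v t (A @ T # B) \<longleftrightarrow> word_state M e (Suc v) (Suc t) (A @ T # x # T # B)"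
proof -
  have absx: "\<bar>x\<bar> = int (Suc v)"
    using assms by (auto simp: abs_mult)
  have m: "mset (map abs (A @ T # B)) = mset_set {1..int v} + replicate_mset t M \<longleftrightarrow>
    mset (map abs (A @ T # x # T # B)) = mset_set {1..int (Suc v)} + replicate_mset (Suc t) M"
    using assms(2) absx unfolding atLeastAtMost_Suc_int by simp
  have hd: "hd (A @ T # B) = hd (A @ T # x # T # B)" by (cases A) auto
  have "if e = even (length A) then x < T else T < x"
    using assms by (cases "0 < T") (auto simp: sgn_if)
  then have "alternating e (A @ T # x # T # B) \<longleftrightarrow> alternating e (A @ T # B)"
    unfolding alternating_triple by blast
  then show ?thesis
    using m hd by (simp add: word_state_def)
qed

text \<open>The height after the step is \<open>t - 1\<close>, so \<open>t - 2\<close> and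
  \<open>t - 1\<close> are the heights of an up and a down step. The additional entry, excluded for
  up steps, has rank 0 if \<open>e\<close> and \<open>t - 1\<close> otherwise; the shift leaves 0 to
  \<open>t - 2\<close>.\<close>

lemma expand_word_state:
  assumes "expand M e v t s' p w s" "word_state M e v t s'" "int (Suc v) < M"
  shows "word_state M e (Suc v) (if p then t - 1 else t + 1) s \<and> 0 \<le> w \<and>
    w \<le> (if p then int t - 2 else int t - 1)"
  using assms(1)
proof cases
  case (up T A B)
  have par: "(e = (0 < T)) = even (length A)"
    using limit_entry_parity[of M e v t A T B] assms up by simp
  have hd: "hd A = (if e then M else - M)"
    using word_state_hd[OF assms(2)] assms(3) up by simp
  then have hdc: "count_list A (if e then M else - M) \<ge> 1"
    using up(6) by (cases A) auto
  have cnt: "count_list s' M + count_list s' (- M) = t"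
    using word_state_count assms by simp
  have M: "M \<noteq> - M" "0 < M" using assms(3) by auto
  then have TM: "T = M \<or> T = - M" using up by auto
  have t: "t = Suc (t - 1)" using cnt hdc up TM M by (auto split: if_splits)
  have "word_state M e (Suc v) (t - 1) s"
    using word_state_up_iff[OF assms(3) up(6) up(5) refl par, of "t - 1" B] t assms(2) up by simp
  moreover have "0 \<le> w \<and> w \<le> int t - 2"
    using TM cnt hdc M up by (auto simp: rank_def split: if_splits)
  ultimately show ?thesis using up by simp
next
  case (down T A B)
  have par: "(e = (0 < T)) = even (length A)"
    using limit_entry_parity[of M e v t A T B] assms down by simp
  have cnt: "count_list s' M + count_list s' (- M) = t"
    using word_state_count assms by simp
  have M: "M \<noteq> - M" "0 < M" using assms(3) by auto
  then have TM: "T = M \<or> T = - M" using down by auto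
  have "0 \<le> w \<and> w \<le> int t - 1"
    using TM cnt M down by (auto simp: rank_def split: if_splits)
  then show ?thesis
    using word_state_down_iff[OF assms(3) down(5) refl par, of t B] assms(2) down by simp
qed

lemma expand_unique:
  assumes "expand M e v t s' p w s1" "expand M e v t s' p w s2"
    "word_state M e v t s'" "int (Suc v) < M"
  shows "s1 = s2"
proof -
  have M: "0 < M" using assms(4) by simp
  have eq: "A = A' \<and> T = T' \<and> B = B'"
    if s: "s' = A @ T # B" "s' = A' @ T' # B'" "\<bar>T\<bar> = M" "\<bar>T'\<bar> = M" "rank t A T = rank t A' T'"
    for A A' B B' T T'
  proof -
    have cnt: "count_list s' M + count_list s' (- M) = t"
      using word_state_count assms by simp
    have b: "count_list A T < count_list s' T" "count_list A' T' < count_list s' T'"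
      by (simp add: s(1)) (simp add: s(2))
    have TM: "T = M \<or> T = - M" "T' = M \<or> T' = - M" using s by auto
    \<comment> \<open>Positive limit entries have ranks below \<open>count_list s' M\<close>,
      negative ones do not, so the rank reveals the sign.\<close>
    have "T = T'"
      using TM b cnt s(5) M by (auto simp: rank_def)
    moreover have "count_list A T = count_list A' T'"
      using calculation s(5) by (auto simp: rank_def split: if_splits)
    ultimately show ?thesis using count_list_split_unique[of A T B A' B'] s by auto
  qed
  show ?thesis
    using assms(1)
  proof cases
    case (up T A B)
    note u = this
    from assms(2) show ?thesis
    proof cases
      case (up T' A' B')
      then show ?thesis using u eq[of A T B A' T' B'] by auto
    qed (use u in auto)
  next
    case (down T A B)
    note d = this
    from assms(2) show ?thesis
    proof cases
      case (down T' A' B')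
      then show ?thesis using d eq[of A T B A' T' B'] by auto
    qed (use d in auto)
  qed
qed

lemma rank_surj:
  assumes "count_list s M + count_list s (- M) = t" "0 < M" "0 \<le> r" "r < int t"
  shows "\<exists>A T B. s = A @ T # B \<and> \<bar>T\<bar> = M \<and> rank t A T = r"
proof (cases "r < int (count_list s M)")
  case True
  then obtain A B where "s = A @ M # B" "count_list A M = nat r"
    using count_list_split[of "nat r" s M] assms(3) by (metis nat_less_iff)
  then show ?thesis using assms
    by (intro exI[of _ A] exI[of _ M] exI[of _ B]) (auto simp: rank_def)
next
  case False
  then have "nat (int t - 1 - r) < count_list s (- M)" using assms by linarith
  then obtain A B where "s = A @ (- M) # B" "count_list A (- M) = nat (int t - 1 - r)"
    using count_list_split by metis
  then show ?thesis using assms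
    by (intro exI[of _ A] exI[of _ "- M"] exI[of _ B]) (auto simp: rank_def)
qed

lemma expand_exists:
  assumes "word_state M e v t s'" "int (Suc v) < M" "0 \<le> w"
    "w \<le> (if p then int t - 2 else int t - 1)"
  shows "\<exists>s. expand M e v t s' p w s"
proof -
  have cnt: "count_list s' M + count_list s' (- M) = t"
    using word_state_count assms by simp
  have M: "0 < M" using assms(2) by simp
  show ?thesis
  proof (cases p)
    case True
    have "0 \<le> w + (if e then 1 else 0)" "w + (if e then 1 else 0) < int t"
      using assms(3,4) True by auto
    then obtain A T B where
      s: "s' = A @ T # B" "\<bar>T\<bar> = M" "rank t A T = w + (if e then 1 else 0)"
      using rank_surj[OF cnt M] by blast
    \<comment> \<open>The additional entry has rank 0 if \<open>e\<close> and \<open>t - 1\<close>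
      otherwise; both contradict the bounds on \<open>w\<close>.\<close>
    have "A \<noteq> []"
    proof
      assume "A = []"
      then have "T = (if e then M else - M)"
        using word_state_hd[OF assms(1)] assms(2) s by simp
      then show False using s assms True \<open>A = []\<close>
        by (auto simp: rank_def split: if_splits)
    qed
    then show ?thesis using expand.up[of T M A e v t B] s True by auto
  next
    case False
    obtain A T B where s: "s' = A @ T # B" "\<bar>T\<bar> = M" "rank t A T = w"
      using rank_surj[OF cnt M, of w] assms False by auto
    then show ?thesis using expand.down[of T M e v t A B] False by auto
  qed
qed

text \<open>A positive peak or negative valley of absolute value \<open>v + 1\<close> is pushed out
  to a limit entry. Otherwise both its neighbours are more extreme than it, hence limit entries of
  its sign, and the three merge.\<close>

lemma expand_collapse:
  assumes "word_state M e (Suc v) t s" "int (Suc v) < M"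
  shows "\<exists>p w s' t'. expand M e v t' s' p w s \<and> word_state M e v t' s' \<and>
    int t = (if p then int t' - 1 else int t' + 1)"
proof -
  have "int (Suc v) \<in># mset_set {1..int (Suc v)} + replicate_mset t M" by simp
  then have "int (Suc v) \<in># mset (map abs s)"
    using assms unfolding word_state_def by metis
  then obtain x where x: "x \<in> set s" "\<bar>x\<bar> = int (Suc v)" by auto
  then obtain A B where s: "s = A @ x # B" by (meson split_list)
  have "A \<noteq> []" using assms s x unfolding word_state_def by auto
  have alt: "alternating e s" using assms by (simp add: word_state_def)
  have M: "0 < M" using assms(2) by simp
  show ?thesis
  proof (cases "(0 < x) = (e = even (length A))")
    case True
    let ?T = "sgn x * M"
    have T: "\<bar>?T\<bar> = M" "x = sgn ?T * int (Suc v)" "(e = (0 < ?T)) = even (length A)"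
      using x M True by (auto simp: abs_mult sgn_if zero_less_mult_iff split: if_splits)
    then have "word_state M e v (Suc t) (A @ ?T # B)"
      using word_state_up_iff[OF assms(2) \<open>A \<noteq> []\<close> T] assms(1) s by simp
    moreover have "expand M e v (Suc t) (A @ ?T # B) True
        (rank (Suc t) A ?T - (if e then 1 else 0)) s"
      using expand.up[OF T(1) \<open>A \<noteq> []\<close>] T(2) s by metis
    ultimately show ?thesis by fastforce
  next
    case False
    obtain A' a where A: "A = A' @ [a]" using \<open>A \<noteq> []\<close> by (meson rev_exhaust)
    have nx: "if e = even (length A) then hd0 B < x else x < hd0 B"
      using alternating_next[of e A x B] alt s by simp
    have "alternating e (A' @ a # x # B)" using alt s A by simp
    from alternating_next[OF this]
    have na: "if e = even (length A') then x < a else a < x" unfolding hd0_simps .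
    \<comment> \<open>As last entry of the reversed word, \<open>x\<close> would be compared with
      the virtual valley 0, against the case assumption.\<close>
    have "B \<noteq> []" using nx False x by (cases B) (auto split: if_splits)
    then obtain b B' where B: "B = b # B'" by (cases B) auto
    let ?T = "sgn x * M"
    have "\<bar>a\<bar> = M \<or> \<bar>a\<bar> \<le> int (Suc v)" "\<bar>b\<bar> = M \<or> \<bar>b\<bar> \<le> int (Suc v)"
      using word_state_abs[OF assms(1), of a] word_state_abs[OF assms(1), of b] s A B by auto
    moreover have "if 0 < x then x < a \<and> x < b else a < x \<and> b < x"
      using nx na False A B by (auto split: if_splits)
    ultimately have "a = ?T" "b = ?T"
      using x M by (auto simp: sgn_if split: if_splits)
    then have s2: "s = A' @ ?T # x # ?T # B'" using s A B by simp
    have T: "\<bar>?T\<bar> = M" "x = sgn ?T * int (Suc v)" "(e = (0 < ?T)) = even (length A')"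
      using x M False A by (auto simp: abs_mult sgn_if zero_less_mult_iff split: if_splits)
    have "count_list s M + count_list s (- M) = t"
      using word_state_count assms by simp
    then have t: "t = Suc (t - 1)" using s2 x M by (auto simp: sgn_if split: if_splits)
    then have "word_state M e v (t - 1) (A' @ ?T # B')"
      using word_state_down_iff[OF assms(2) T, of "t - 1" B'] assms(1) s2 by simp
    moreover have "expand M e v (t - 1) (A' @ ?T # B') False (rank (t - 1) A' ?T) s"
      using expand.down[OF T(1)] T(2) s2 by metis
    ultimately show ?thesis using t by fastforce
  qed
qed

section \<open>Crossing codes under expansion\<close>

text \<open>For positive \<open>T\<close>, the entries above \<open>v + 1\<close> are the copies of
  \<open>T\<close>; for negative \<open>T\<close> the bits are complemented, which
  \<open>changes\<close> does not notice.\<close>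

lemma changes_limit:
  assumes "\<forall>z\<in>set L. \<bar>z\<bar> = \<bar>T\<bar> \<or> \<bar>z\<bar> \<le> int v" "int (Suc v) < \<bar>T\<bar>"
  shows "changes (map (\<lambda>z. sgn T * int (Suc v) < z) L) = changes (map (\<lambda>z. z = T) L)"
proof (cases "0 < T")
  case True
  then have "map (\<lambda>z. sgn T * int (Suc v) < z) L = map (\<lambda>z. z = T) L"
    using assms by auto
  then show ?thesis by (rule arg_cong)
next
  case False
  then have "map (\<lambda>z. sgn T * int (Suc v) < z) L = map Not (map (\<lambda>z. z = T) L)"
    using assms by (fastforce simp: sgn_if)
  then show ?thesis by (simp only: changes_Not)
qed

lemma before_append_notin: "x \<notin> set A \<Longrightarrow> before x (A @ x # B) = A"
  unfolding before_def by (induction A) auto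

text \<open>Entries before \<open>x\<close> are limit entries or smaller in absolute value, so the
  crossings of \<open>x\<close> count the earlier copies of \<open>T\<close>. For negative
  \<open>T\<close>, subtraction from the height \<open>h\<close> produces the reversed
  ranking.\<close>

lemma expand_first_step:
  assumes "expand M e v t s' p w s" "word_state M e v t s'" "int (Suc v) < M"
    "x = signed_entry (int (Suc v)) s" "h = (if p then int t - 2 else int t - 1)"
  shows "upward e x s = p \<and> (if 0 < x then int (crossing_code x s) else h - int (crossing_code x s)) = w"
proof -
  have M: "0 < M" using assms(3) by simp
  have alt: "alternating e s'" using assms(2) by (simp add: word_state_def)
  have vals: "\<bar>z\<bar> = M \<or> \<bar>z\<bar> \<le> int v" if "z \<in> set s'" for z
    using word_state_abs[OF assms(2) that] by auto
  have marked: "marked_at (e = (0 < T)) (map (\<lambda>z. z = T) A)"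
    if "s' = A @ R" "\<bar>T\<bar> = M" for A R T
    using alt vals assms(3) that by (intro marked_at_limit[of e A R M]) force+
  show ?thesis
    using assms(1)
  proof cases
    case (up T A B)
    let ?x = "sgn T * int (Suc v)" and ?D = "map (\<lambda>z. z = T) A"
    have par: "(e = (0 < T)) = even (length A)"
      using limit_entry_parity[of M e v t A T B] assms up by simp
    have hd: "hd A = (if e then M else - M)"
      using word_state_hd[OF assms(2)] assms(3) up by simp
    have absx: "\<bar>?x\<bar> = int (Suc v)" using up M by (auto simp: abs_mult)
    have notin: "z \<notin> set A \<union> set B" if "\<bar>z\<bar> = int (Suc v)" for z
      using vals[of z] that up assms(3) by auto
    have x: "x = ?x"
      using assms(4) up notin[of "int (Suc v)"] M
      by (auto simp: signed_entry_def sgn_if split: if_splits)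
    have bef: "before x s = A"
      using before_append_notin[of x A B] notin[of x] absx x up by simp
    have "changes (map (\<lambda>z. ?x < z) (tl A)) = changes (map (\<lambda>z. z = T) (tl A))"
      using vals up assms(3) by (intro changes_limit) (auto dest: list.set_sel(2)[rotated])
    then have "crossing_code x s = changes (tl ?D)"
      unfolding crossing_code_def bef by (simp only: x map_tl)
    also have "int (changes (tl ?D)) = int (count_list A T) - (if e = (0 < T) then 1 else 0)"
    proof -
      have "hd ?D = (e = (0 < T))"
        using up hd M by (auto simp: hd_map abs_if split: if_splits)
      then show ?thesis
        using changes_tl[OF marked[of A "T # B" T]] up par by (simp add: count_list_map_eq)
    qed
    finally have c: "int (crossing_code x s) = int (count_list A T) - (if e = (0 < T) then 1 else 0)" .
    have "0 < x \<longleftrightarrow> 0 < T" using x up M by (auto simp: zero_less_mult_iff sgn_if)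
    \<comment> \<open>For negative \<open>T\<close> the code is corrected by 1 exactly if
      \<open>e\<close> fails; subtracted from \<open>t - 2\<close>, it gives
      \<open>rank t A T\<close>, lowered by 1 exactly if \<open>e\<close> holds.\<close>
    then show ?thesis
      using c par bef up assms(5) by (auto simp: upward_def rank_def)
  next
    case (down T A B)
    let ?x = "sgn T * int (Suc v)" and ?D = "map (\<lambda>z. z = T) A"
    have par: "(e = (0 < T)) = even (length A)"
      using limit_entry_parity[of M e v t A T B] assms down by simp
    have hd: "A \<noteq> [] \<Longrightarrow> hd A = (if e then M else - M)"
      using word_state_hd[OF assms(2)] assms(3) down by simp
    have absx: "\<bar>?x\<bar> = int (Suc v)" using down M by (auto simp: abs_mult)
    have notin: "z \<notin> insert T (set A \<union> set B)" if "\<bar>z\<bar> = int (Suc v)" for z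
      using vals[of z] that down assms(3) by auto
    have x: "x = ?x"
      using assms(4) down notin[of "int (Suc v)"] M
      by (auto simp: signed_entry_def sgn_if split: if_splits)
    have bef: "before x s = A @ [T]"
      using before_append_notin[of x "A @ [T]" "T # B"] notin[of x] absx x down by simp
    have "changes (map (\<lambda>z. ?x < z) (tl (A @ [T]))) = changes (map (\<lambda>z. z = T) (tl (A @ [T])))"
    proof (rule changes_limit)
      have "set (tl (A @ [T])) \<subseteq> set s'" using down by (cases A) auto
      then show "\<forall>z\<in>set (tl (A @ [T])). \<bar>z\<bar> = \<bar>T\<bar> \<or> \<bar>z\<bar> \<le> int v" using vals down by auto
      show "int (Suc v) < \<bar>T\<bar>" using down assms(3) by simp
    qed
    then have "crossing_code x s = changes (tl (?D @ [True]))"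
      unfolding crossing_code_def bef by (simp only: x map_tl map_append list.map refl)
    also have "changes (tl (?D @ [True])) = count_list A T"
    proof -
      have "hd ?D = (e = (0 < T))" if "?D \<noteq> []"
        using that down hd M by (auto simp: hd_map abs_if split: if_splits)
      then show ?thesis
        using changes_tl_snoc[OF marked[of A "T # B" T]] down par
        by (simp add: count_list_map_eq)
    qed
    finally have c: "crossing_code x s = count_list A T" .
    have "0 < x \<longleftrightarrow> 0 < T" using x down M by (auto simp: zero_less_mult_iff sgn_if)
    then show ?thesis
      using c par bef down assms(5) by (auto simp: upward_def rank_def)
  qed
qed

lemma encode_cong:
  assumes "\<And>k. 1 \<le> k \<Longrightarrow> k \<le> int v \<Longrightarrow> signed_entry k s = signed_entry k s' \<and>
    crossing_code (signed_entry k s') s = crossing_code (signed_entry k s') s' \<and>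
    upward e (signed_entry k s') s = upward e (signed_entry k s') s'"
  shows "encode e y v s = encode e y v s'"
  using assms by (induction v arbitrary: y) (auto simp: Let_def)

lemma before_append_in: "x \<in> set A \<Longrightarrow> before x (A @ B) = before x A"
  unfolding before_def by (induction A) auto

lemma before_append_cons: "x \<notin> set A \<Longrightarrow> x \<noteq> a \<Longrightarrow> before x (A @ a # B) = A @ a # before x B"
  unfolding before_def by (induction A) auto

lemma before_cons: "x \<noteq> a \<Longrightarrow> before x (a # B) = a # before x B"
  unfolding before_def by simp

text \<open>An \<open>x\<close> of smaller absolute value compares alike with \<open>T\<close> and
  with the new entry, so a bit is kept or tripled; neither affects \<open>changes\<close> or the
  parity of the prefix.\<close>

lemma expand_stable:
  assumes "expand M e v t s' p w s" "int (Suc v) < M" "\<bar>x\<bar> \<le> int v"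
  shows "crossing_code x s = crossing_code x s' \<and> upward e x s = upward e x s' \<and> (x \<in> set s \<longleftrightarrow> x \<in> set s')"
  using assms(1)
proof cases
  case (up T A B)
  let ?x = "sgn T * int (Suc v)"
  have ne: "x \<noteq> T" "x \<noteq> ?x" "(x < ?x) = (x < T)"
    using assms(2,3) up by (auto simp: sgn_if)
  show ?thesis
  proof (cases "x \<in> set A")
    case True
    then show ?thesis using up by (simp add: crossing_code_def upward_def before_append_in)
  next
    case False
    have b: "before x s = A @ ?x # before x B" "before x s' = A @ T # before x B"
      using False ne up by (auto simp: before_append_cons)
    have "crossing_code x s = crossing_code x s'"
      unfolding crossing_code_def b using ne by (cases A) simp_all
    moreover have "upward e x s = upward e x s'"
      unfolding upward_def b by simp
    ultimately show ?thesis using up ne by auto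
  qed
next
  case (down T A B)
  let ?x = "sgn T * int (Suc v)"
  have ne: "x \<noteq> T" "x \<noteq> ?x" "(x < ?x) = (x < T)"
    using assms(2,3) down by (auto simp: sgn_if)
  show ?thesis
  proof (cases "x \<in> set A")
    case True
    then show ?thesis using down ne by (simp add: crossing_code_def upward_def before_append_in)
  next
    case False
    have b: "before x s = A @ T # ?x # T # before x B" "before x s' = A @ T # before x B"
      using False ne down by (auto simp: before_append_cons before_cons)
    \<comment> \<open>If \<open>A = []\<close>, \<open>tl\<close> removes the first \<open>T\<close>
      and leaves an extra pair of equal bits, which contributes 0.\<close>
    have "crossing_code x s = crossing_code x s'"
      unfolding crossing_code_def b using ne
      by (cases A) (simp_all add: changes_triple)
    moreover have "upward e x s = upward e x s'"
      unfolding upward_def b by simp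
    ultimately show ?thesis using down ne by auto
  qed
qed

text \<open>The height before the step is \<open>t - 2\<close> or \<open>t\<close>, after it
  \<open>t - 1\<close>; the tail agrees because the codes of smaller entries are stable.\<close>

lemma expand_encode:
  assumes "expand M e v t s' p w s" "word_state M e v t s'" "int (Suc v) < M"
  shows "encode e (if p then int t - 2 else int t) (Suc v) s = (p, w) # encode e (int t - 1) v s'"
proof -
  have "encode e y v s = encode e y v s'" for y
    using expand_stable[OF assms(1,3)] by (intro encode_cong) (auto simp: signed_entry_def)
  moreover have "upward e (signed_entry (int (Suc v)) s) s = p \<and>
    (if 0 < signed_entry (int (Suc v)) s then int (crossing_code (signed_entry (int (Suc v)) s) s)
     else (if p then int t - 2 else int t - 1) - int (crossing_code (signed_entry (int (Suc v)) s) s)) = w"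
    using expand_first_step[OF assms refl refl] .
  ultimately show ?thesis
    by (cases p) (auto simp: Let_def)
qed

section \<open>The bijection\<close>

text \<open>Only the final height needs an explicit \<open>0 \<le> y\<close>: before a step it
  follows from \<open>0 \<le> w\<close> and the bound by the height of the step.\<close>

fun labeled_steps :: "int \<Rightarrow> (bool \<times> int) list \<Rightarrow> bool" where
  "labeled_steps y [] \<longleftrightarrow> 0 \<le> y"
| "labeled_steps y ((p, w) # q) \<longleftrightarrow> 0 \<le> w \<and> w \<le> (if p then y else y - 1) \<and>
     labeled_steps (if p then y + 1 else y - 1) q"

lemma word_state_zero:
  assumes "0 < M" "e = odd t"
  shows "{s. word_state M e 0 t s} = (if t = 0 then {} else {limit_word M e t})"
proof (cases t)
  case 0
  then show ?thesis by (auto simp: word_state_def)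
next
  case (Suc t')
  have "s = limit_word M e t" if "word_state M e 0 t s" for s
  proof -
    have "mset (map abs s) = mset (replicate t M)" using that by (simp add: word_state_def)
    from mset_eq_setD[OF this] mset_eq_length[OF this] have "\<forall>z\<in>set s. \<bar>z\<bar> = M"
      "length s = t"
      using Suc by auto
    then show ?thesis
      using alternating_extremal_unique[OF assms(1), of e s] that by (simp add: word_state_def)
  qed
  moreover have "word_state M e 0 t (limit_word M e t)"
  proof -
    have "mset (map abs (limit_word M e t)) = replicate_mset t M"
      by (simp only: abs_limit_word[OF assms(1)] mset_replicate)
    moreover have "limit_word M e t \<noteq> []" "\<bar>hd (limit_word M e t)\<bar> = M"
      using Suc assms(1) by auto
    ultimately show ?thesis
      using alternating_limit_word[OF assms] by (simp add: word_state_def)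
  qed
  ultimately have "{s. word_state M e 0 t s} = {limit_word M e t}" by blast
  then show ?thesis using Suc by simp
qed

text \<open>Induction on \<open>v\<close> with \<open>t\<close> varying, as each step changes the
  number of limit entries. At \<open>t = 0\<close>, height \<open>- 1\<close>, both sides are empty.
  The condition on \<open>e\<close> is the parity of the length forced by alternation.\<close>

lemma encode_bij:
  assumes "int v < M" "e = odd (v + t)"
  shows "bij_betw (encode e (int t - 1) v) {s. word_state M e v t s}
    {q. length q = v \<and> labeled_steps (int t - 1) q}"
  using assms
proof (induction v arbitrary: t)
  case 0
  have "{q. length q = 0 \<and> labeled_steps (int t - 1) q} = (if t = 0 then {} else {[]})"
    by auto
  then show ?case using word_state_zero[of M e t] 0 by (simp add: bij_betw_def)
next
  case (Suc v)
  have v: "int v < M" using Suc.prems by simp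
  have collapse: "\<exists>p w s' t'. expand M e v t' s' p w s \<and> word_state M e v t' s' \<and>
      int t - 1 = (if p then int t' - 2 else int t') \<and> 0 \<le> w \<and>
      w \<le> (if p then int t - 1 else int t - 2) \<and> e = odd (v + t') \<and>
      encode e (int t - 1) (Suc v) s = (p, w) # encode e (int t' - 1) v s'"
    if st: "word_state M e (Suc v) t s" for s
  proof -
    obtain p w s' t' where *: "expand M e v t' s' p w s" "word_state M e v t' s'"
      "int t = (if p then int t' - 1 else int t' + 1)"
      using expand_collapse[OF st Suc.prems(1)] by blast
    have y: "int t - 1 = (if p then int t' - 2 else int t')" using *(3) by simp
    moreover have "0 \<le> w" "w \<le> (if p then int t - 1 else int t - 2)"
      using expand_word_state[OF *(1,2) Suc.prems(1)] *(3) by auto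
    moreover have "t' = (if p then t + 1 else t - 1)" "p \<or> 0 < t"
      using *(3) by (auto split: if_splits)
    then have "e = odd (v + t')" using Suc.prems(2) by auto
    moreover have "encode e (int t - 1) (Suc v) s = (p, w) # encode e (int t' - 1) v s'"
      using expand_encode[OF *(1,2) Suc.prems(1)] unfolding y .
    ultimately show ?thesis using *(1,2) by blast
  qed
  show ?case
    unfolding bij_betw_def
  proof (intro conjI inj_onI subset_antisym subsetI)
    fix s1 s2
    assume s: "s1 \<in> {s. word_state M e (Suc v) t s}" "s2 \<in> {s. word_state M e (Suc v) t s}"
      "encode e (int t - 1) (Suc v) s1 = encode e (int t - 1) (Suc v) s2"
    obtain p w s1' t' where 1: "expand M e v t' s1' p w s1" "word_state M e v t' s1'"
      "int t - 1 = (if p then int t' - 2 else int t')" "e = odd (v + t')"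
      "encode e (int t - 1) (Suc v) s1 = (p, w) # encode e (int t' - 1) v s1'"
      using collapse[of s1] s(1) by blast
    obtain p2 w2 s2' t2' where 2: "expand M e v t2' s2' p2 w2 s2" "word_state M e v t2' s2'"
      "int t - 1 = (if p2 then int t2' - 2 else int t2')"
      "encode e (int t - 1) (Suc v) s2 = (p2, w2) # encode e (int t2' - 1) v s2'"
      using collapse[of s2] s(2) by blast
    have pw: "p2 = p" "w2 = w" "encode e (int t' - 1) v s1' = encode e (int t2' - 1) v s2'"
      using 1(5) 2(4) s(3) by auto
    \<comment> \<open>The direction \<open>p\<close> together with \<open>t\<close> determines the
      number of limit entries of the collapsed word.\<close>
    then have t2: "t2' = t'" using 1(3) 2(3) by (auto split: if_splits)
    have "s1' = s2'"
      using Suc.IH[OF v 1(4)] 1(2) 2(2) pw t2 by (auto simp: bij_betw_def inj_on_def)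
    then show "s1 = s2"
      using expand_unique 1(1,2) 2(1) pw t2 Suc.prems(1) by blast
  next
    fix q assume "q \<in> encode e (int t - 1) (Suc v) ` {s. word_state M e (Suc v) t s}"
    then obtain s where s: "word_state M e (Suc v) t s" "q = encode e (int t - 1) (Suc v) s"
      by blast
    obtain p w s' t' where *: "word_state M e v t' s'"
      "int t - 1 = (if p then int t' - 2 else int t')" "e = odd (v + t')"
      "0 \<le> w" "w \<le> (if p then int t - 1 else int t - 2)"
      "q = (p, w) # encode e (int t' - 1) v s'"
      using collapse[OF s(1)] s(2) by blast
    have "encode e (int t' - 1) v s' \<in> {q. length q = v \<and> labeled_steps (int t' - 1) q}"
      using bij_betwE[OF Suc.IH[OF v *(3)]] *(1) by blast
    moreover have "int t' - 1 = (if p then int t - 1 + 1 else int t - 1 - 1)"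
      using *(2) by (auto split: if_splits)
    ultimately show "q \<in> {q. length q = Suc v \<and> labeled_steps (int t - 1) q}"
      using *(4-6) by auto
  next
    fix q assume q: "q \<in> {q. length q = Suc v \<and> labeled_steps (int t - 1) q}"
    then obtain p w q' where q': "q = (p, w) # q'" by (cases q) auto
    define t' where "t' = (if p then t + 1 else t - 1)"
    \<comment> \<open>A down step has \<open>0 \<le> w\<close> and \<open>w \<le> int t - 2\<close>,
      so the natural number \<open>t - 1\<close> is not truncated.\<close>
    have t: "p \<or> 0 < t" using q q' by (auto split: if_splits)
    have y: "int t' - 1 = (if p then int t - 1 + 1 else int t - 1 - 1)"
      using t by (auto simp: t'_def)
    have par: "e = odd (v + t')" using Suc.prems(2) t by (auto simp: t'_def)
    have "q' \<in> {q. length q = v \<and> labeled_steps (int t' - 1) q}"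
      using q q' y by auto
    then obtain s' where s': "word_state M e v t' s'" "q' = encode e (int t' - 1) v s'"
      using bij_betw_imp_surj_on[OF Suc.IH[OF v par]] by blast
    have "0 \<le> w" "w \<le> (if p then int t' - 2 else int t' - 1)"
      using q q' y by (auto split: if_splits)
    then obtain s where s: "expand M e v t' s' p w s"
      using expand_exists[OF s'(1) Suc.prems(1)] by blast
    have "word_state M e (Suc v) t s"
      using expand_word_state[OF s s'(1) Suc.prems(1)] t by (auto simp: t'_def split: if_splits)
    moreover have y': "int t - 1 = (if p then int t' - 2 else int t')"
      using t by (auto simp: t'_def)
    have "encode e (int t - 1) (Suc v) s = q"
      using expand_encode[OF s s'(1) Suc.prems(1)] unfolding y' q' s'(2) .
    ultimately show "q \<in> encode e (int t - 1) (Suc v) ` {s. word_state M e (Suc v) t s}"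
      by blast
  qed
qed

section \<open>Snakes as words with one limit entry\<close>

definition lift :: "nat \<Rightarrow> int list \<Rightarrow> int list" where
  "lift n \<pi> = (if even n then int n + 1 else - (int n + 1)) # rev \<pi>"

lemma signed_perm_iff_mset: "signed_perm n \<pi> \<longleftrightarrow> mset (map abs \<pi>) = mset_set {1..int n}"
proof
  assume p: "signed_perm n \<pi>"
  then have "mset (map abs \<pi>) = mset_set (set (map abs \<pi>))"
    unfolding signed_perm_def using mset_set_set by metis
  then show "mset (map abs \<pi>) = mset_set {1..int n}"
    using p unfolding signed_perm_def by metis
next
  assume m: "mset (map abs \<pi>) = mset_set {1..int n}"
  have "size (mset (map abs \<pi>)) = n" unfolding m by simp
  then have len: "length \<pi> = n" by simp
  have "set_mset (mset (map abs \<pi>)) = {1..int n}" unfolding m by simp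
  then have set: "set (map abs \<pi>) = {1..int n}" by simp
  have "card (set (map abs \<pi>)) = length (map abs \<pi>)" unfolding set using len by simp
  then have "distinct (map abs \<pi>)" by (rule card_distinct)
  then show "signed_perm n \<pi>" using len set by (simp add: signed_perm_def)
qed

lemma alternating_lift:
  assumes "signed_perm n \<pi>" "n \<ge> 1"
  shows "alternating (even n) (lift n \<pi>) \<longleftrightarrow> snake n \<pi>"
proof -
  have len: "length \<pi> = n" using assms(1) by (simp add: signed_perm_def)
  let ?s = "lift n \<pi>"
  have cur: "?s ! Suc i = ent \<pi> (n - i)" if "i < n" for i
    using that len by (simp add: lift_def ent_def rev_nth)
  have next_: "(?s @ [0]) ! Suc i = (if i < n then ent \<pi> (n - i) else 0)" if "i \<le> n" for i
    using that len by (auto simp: lift_def ent_def rev_nth nth_append)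
  \<comment> \<open>The comparison at the additional entry always holds, as \<open>n + 1\<close>
    exceeds all absolute values.\<close>
  have "\<bar>ent \<pi> n\<bar> \<in> set (map abs \<pi>)" using len assms(2) by (auto simp: ent_def)
  then have "\<bar>ent \<pi> n\<bar> \<le> int n" using assms(1) by (simp add: signed_perm_def)
  then have first: "if even n then ent \<pi> n < ?s ! 0 else ?s ! 0 < ent \<pi> n"
    by (auto simp: lift_def)
  let ?C = "\<lambda>i. if even n = even i then (?s @ [0]) ! Suc i < ?s ! i else ?s ! i < (?s @ [0]) ! Suc i"
  \<comment> \<open>The condition between positions \<open>j - 1\<close> and \<open>j\<close> of
    \<pi>, with 0 standing at position 0.\<close>
  define D where "D j \<longleftrightarrow> (if odd j then (if j = 1 then 0 else ent \<pi> (j - 1)) < ent \<pi> j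
    else ent \<pi> j < (if j = 1 then 0 else ent \<pi> (j - 1)))" for j
  have C_iff_D: "?C (Suc i) \<longleftrightarrow> D (n - i)" if "i < n" for i
  proof -
    have "(even n = even (Suc i)) = odd (n - i)" using that by auto
    moreover have "(?s @ [0]) ! Suc (Suc i) = (if n - i = 1 then 0 else ent \<pi> (n - i - 1))"
      using next_[of "Suc i"] that by auto
    ultimately show ?thesis unfolding D_def by (simp only: cur[OF that])
  qed
  have "alternating (even n) ?s \<longleftrightarrow> (\<forall>i<Suc n. ?C i)"
    unfolding alternating_nth using len by (simp add: lift_def)
  also have "\<dots> \<longleftrightarrow> ?C 0 \<and> (\<forall>i<n. ?C (Suc i))" by (rule All_less_Suc2)
  also have "?C 0 \<longleftrightarrow> True"
    using first next_[of 0] assms(2) by (auto split: if_splits)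
  also have "(\<forall>i<n. ?C (Suc i)) \<longleftrightarrow> (\<forall>j. 1 \<le> j \<and> j \<le> n \<longrightarrow> D j)"
  proof (intro iffI allI impI)
    fix j assume C: "\<forall>i<n. ?C (Suc i)" and j: "1 \<le> j \<and> j \<le> n"
    then have "n - j < n" "n - (n - j) = j" by auto
    then show "D j" using C C_iff_D[of "n - j"] by auto
  next
    fix i assume "\<forall>j. 1 \<le> j \<and> j \<le> n \<longrightarrow> D j" and i: "i < n"
    then have "D (n - i)" by simp
    then show "?C (Suc i)" using C_iff_D[OF i] by blast
  qed
  also have "\<dots> \<longleftrightarrow> 0 < ent \<pi> 1 \<and> (\<forall>i. 1 \<le> i \<and> i < n \<longrightarrow>
      (if odd i then ent \<pi> i > ent \<pi> (i + 1) else ent \<pi> i < ent \<pi> (i + 1)))"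
    (is "_ \<longleftrightarrow> _ \<and> (\<forall>i. _ \<longrightarrow> ?R i)")
  proof -
    have D1: "D 1 \<longleftrightarrow> 0 < ent \<pi> 1" by (simp add: D_def)
    have DS: "D (Suc i) \<longleftrightarrow> ?R i" if "1 \<le> i" for i using that by (auto simp: D_def)
    show ?thesis
    proof (intro iffI conjI allI impI)
      assume "\<forall>j. 1 \<le> j \<and> j \<le> n \<longrightarrow> D j"
      then show "0 < ent \<pi> 1" using D1 assms(2) by blast
    next
      fix i assume "\<forall>j. 1 \<le> j \<and> j \<le> n \<longrightarrow> D j" and i: "1 \<le> i \<and> i < n"
      then have "D (Suc i)" by simp
      then show "?R i" using DS i by blast
    next
      fix j assume R: "0 < ent \<pi> 1 \<and> (\<forall>i. 1 \<le> i \<and> i < n \<longrightarrow> ?R i)" and j: "1 \<le> j \<and> j \<le> n"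
      show "D j"
      proof (cases "j = 1")
        case True
        then show ?thesis using R D1 by blast
      next
        case False
        then obtain i where i: "j = Suc i" "1 \<le> i" using j by (cases j) auto
        then have "?R i" using R j by (metis Suc_le_eq)
        then show ?thesis using DS i by blast
      qed
    qed
  qed
  finally show ?thesis using assms by (simp add: snake_def)
qed

lemma word_state_lift:
  assumes "n \<ge> 1"
  shows "word_state (int n + 1) (even n) n 1 (lift n \<pi>) \<longleftrightarrow> snake n \<pi>"
proof -
  have "mset (map abs (lift n \<pi>)) = mset_set {1..int n} + replicate_mset 1 (int n + 1) \<longleftrightarrow>
      signed_perm n \<pi>"
  proof -
    have "mset (map abs (lift n \<pi>)) = add_mset (int n + 1) (mset (map abs \<pi>))"
      by (simp add: lift_def add.commute)
    then show ?thesis unfolding signed_perm_iff_mset by simp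
  qed
  moreover have "lift n \<pi> \<noteq> []" "\<bar>hd (lift n \<pi>)\<bar> = int n + 1" by (auto simp: lift_def)
  moreover have "snake n \<pi> \<Longrightarrow> signed_perm n \<pi>" by (simp add: snake_def)
  ultimately show ?thesis
    unfolding word_state_def using alternating_lift[OF _ assms] by blast
qed

lemma lift_bij:
  assumes "n \<ge> 1"
  shows "bij_betw (lift n) {\<pi>. snake n \<pi>} {s. word_state (int n + 1) (even n) n 1 s}"
  unfolding bij_betw_def
proof (intro conjI inj_onI subset_antisym subsetI)
  show "\<pi> = \<pi>'" if "lift n \<pi> = lift n \<pi>'" for \<pi> \<pi>'
    using that by (simp add: lift_def)
  show "s \<in> {s. word_state (int n + 1) (even n) n 1 s}" if "s \<in> lift n ` {\<pi>. snake n \<pi>}" for s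
    using that word_state_lift[OF assms] by auto
  fix s assume "s \<in> {s. word_state (int n + 1) (even n) n 1 s}"
  then have s: "word_state (int n + 1) (even n) n 1 s" by simp
  have "s \<noteq> []" using s by (simp add: word_state_def)
  \<comment> \<open>The head is forced by the flag \<open>even n\<close>, so the tail determines the
    word.\<close>
  then have "s = lift n (rev (tl s))"
    using word_state_hd[OF s] by (cases s) (auto simp: lift_def)
  then show "s \<in> lift n ` {\<pi>. snake n \<pi>}"
    using s word_state_lift[OF assms, of "rev (tl s)"] by auto
qed

section \<open>Positions, signs and inversion codes in a lifted snake\<close>

lemma ent_eq_iff:
  assumes "signed_perm n \<pi>" "a \<in> {1..n}" "b \<in> {1..n}"
  shows "\<bar>ent \<pi> a\<bar> = \<bar>ent \<pi> b\<bar> \<longleftrightarrow> a = b"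
proof -
  have "distinct (map abs \<pi>)" "length \<pi> = n" using assms(1) by (auto simp: signed_perm_def)
  then have "map abs \<pi> ! (a - 1) = map abs \<pi> ! (b - 1) \<longleftrightarrow> a - 1 = b - 1"
    using assms(2,3) by (subst nth_eq_iff_index_eq) auto
  then show ?thesis using assms(2,3) \<open>length \<pi> = n\<close> by (auto simp: ent_def)
qed

lemma posn_ent:
  assumes "signed_perm n \<pi>" "i \<in> {1..n}"
  shows "posn \<pi> \<bar>ent \<pi> i\<bar> = i"
  unfolding posn_def
proof (rule the_equality)
  have len: "length \<pi> = n" using assms(1) by (simp add: signed_perm_def)
  show "1 \<le> i \<and> i \<le> length \<pi> \<and> \<bar>ent \<pi> i\<bar> = \<bar>ent \<pi> i\<bar>" using assms(2) len by simp
  show "j = i" if "1 \<le> j \<and> j \<le> length \<pi> \<and> \<bar>ent \<pi> j\<bar> = \<bar>ent \<pi> i\<bar>" for j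
    using that ent_eq_iff[OF assms(1), of j i] assms(2) len by simp
qed

lemma signed_perm_position:
  assumes "signed_perm n \<pi>" "k \<in> {1..int n}"
  obtains i where "i \<in> {1..n}" "\<bar>ent \<pi> i\<bar> = k"
proof -
  have "k \<in> set (map abs \<pi>)" "length \<pi> = n" using assms by (auto simp: signed_perm_def)
  then obtain j where "j < n" "\<bar>\<pi> ! j\<bar> = k" by (auto simp: in_set_conv_nth)
  then show ?thesis using that[of "Suc j"] by (simp add: ent_def)
qed

lemma before_lift:
  assumes "signed_perm n \<pi>" "i \<in> {1..n}"
  shows "before (ent \<pi> i) (lift n \<pi>) = hd (lift n \<pi>) # rev (drop i \<pi>)"
proof -
  have len: "length \<pi> = n" using assms(1) by (simp add: signed_perm_def)
  then have "i - 1 < length \<pi>" "Suc (i - 1) = i" using assms(2) by auto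
  then have \<pi>: "\<pi> = take (i - 1) \<pi> @ ent \<pi> i # drop i \<pi>"
    unfolding ent_def by (metis id_take_nth_drop)
  have "\<bar>ent \<pi> i\<bar> \<in> set (map abs \<pi>)" using assms(2) len by (auto simp: ent_def)
  then have "ent \<pi> i \<noteq> hd (lift n \<pi>)" using assms(1) by (auto simp: signed_perm_def lift_def)
  moreover have "distinct \<pi>" using assms(1) by (simp add: signed_perm_def distinct_map)
  then have "ent \<pi> i \<notin> set (drop i \<pi>)" by (subst (asm) \<pi>) simp
  moreover have "lift n \<pi> = (hd (lift n \<pi>) # rev (drop i \<pi>)) @ ent \<pi> i # rev (take (i - 1) \<pi>)"
    by (subst (1) lift_def, subst \<pi>) (simp add: lift_def)
  ultimately show ?thesis using before_append_notin by (metis in_set_conv_decomp set_ConsD set_rev)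
qed

lemma signed_entry_lift:
  assumes "signed_perm n \<pi>" "i \<in> {1..n}"
  shows "signed_entry \<bar>ent \<pi> i\<bar> (lift n \<pi>) = ent \<pi> i"
proof -
  have len: "length \<pi> = n" using assms(1) by (simp add: signed_perm_def)
  have le: "\<bar>ent \<pi> j\<bar> \<le> int n \<and> 1 \<le> \<bar>ent \<pi> j\<bar>" if "j \<in> {1..n}" for j
  proof -
    have "\<bar>ent \<pi> j\<bar> \<in> set (map abs \<pi>)" using that len by (auto simp: ent_def)
    then show ?thesis using assms(1) by (simp add: signed_perm_def)
  qed
  have "\<bar>ent \<pi> i\<bar> \<in> set (lift n \<pi>) \<longleftrightarrow> \<bar>ent \<pi> i\<bar> \<in> set \<pi>"
    using le[OF assms(2)] by (auto simp: lift_def)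
  also have "\<dots> \<longleftrightarrow> \<bar>ent \<pi> i\<bar> = ent \<pi> i"
  proof
    assume "\<bar>ent \<pi> i\<bar> \<in> set \<pi>"
    then obtain j where "j < n" "\<pi> ! j = \<bar>ent \<pi> i\<bar>" using len by (auto simp: in_set_conv_nth)
    then have "ent \<pi> (Suc j) = \<bar>ent \<pi> i\<bar>" "Suc j \<in> {1..n}" by (auto simp: ent_def)
    moreover from this have "Suc j = i" using ent_eq_iff[OF assms(1), of "Suc j" i] assms(2) by simp
    ultimately show "\<bar>ent \<pi> i\<bar> = ent \<pi> i" by simp
  next
    assume "\<bar>ent \<pi> i\<bar> = ent \<pi> i"
    moreover have "ent \<pi> i \<in> set \<pi>" using assms(2) len by (auto simp: ent_def)
    ultimately show "\<bar>ent \<pi> i\<bar> \<in> set \<pi>" by simp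
  qed
  finally show ?thesis by (auto simp: signed_entry_def)
qed

lemma upward_lift:
  assumes "signed_perm n \<pi>" "i \<in> {1..n}"
  shows "upward (even n) (ent \<pi> i) (lift n \<pi>) = (if 0 < ent \<pi> i then odd i else even i)"
proof -
  have "length \<pi> = n" using assms(1) by (simp add: signed_perm_def)
  then have "length (before (ent \<pi> i) (lift n \<pi>)) = Suc (n - i)"
    using before_lift[OF assms] by simp
  then show ?thesis using assms(2) by (auto simp: upward_def)
qed

text \<open>Pairs are formed from the right end of \<pi>; pair \<open>l\<close> corresponds to
  \<open>k = n div 2 - l\<close>, at positions \<open>2*k\<close> and \<open>2*k - 1\<close> for
  even \<open>n\<close>, \<open>2*k + 1\<close> and \<open>2*k\<close> for odd \<open>n\<close>.
  Alternation tells which entry is smaller, so unequal bits mean that the pair encloses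
  \<open>?x\<close>.\<close>

lemma crossing_code_lift:
  assumes "snake n \<pi>" "i \<in> {1..n}"
  shows "crossing_code (ent \<pi> i) (lift n \<pi>) = inv_code n \<pi> i"
proof -
  let ?x = "ent \<pi> i" and ?D = "map (\<lambda>z. ent \<pi> i < z) (rev (drop i \<pi>))"
  have sp: "signed_perm n \<pi>" using assms(1) by (simp add: snake_def)
  have len: "length \<pi> = n" using sp by (simp add: signed_perm_def)
  have alt: "if odd j then ent \<pi> j > ent \<pi> (j + 1) else ent \<pi> j < ent \<pi> (j + 1)"
    if "1 \<le> j" "j < n" for j
    using assms(1) that unfolding snake_def by blast
  have ne: "ent \<pi> j \<noteq> ?x" if "i < j" "j \<le> n" for j
    using ent_eq_iff[OF sp, of j i] that assms(2) by auto
  have nth: "?D ! j = (?x < ent \<pi> (n - j))" if "j < n - i" for j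
    using that len by (simp add: rev_nth ent_def)
  let ?L = "{l. 2 * l + 1 < length ?D \<and> ?D ! (2 * l) \<noteq> ?D ! (2 * l + 1)}"
  have L: "?L = {l. 2 * l + 1 < n - i \<and> (?x < ent \<pi> (n - 2 * l)) \<noteq> (?x < ent \<pi> (n - (2 * l + 1)))}"
    using len nth by auto
  have "crossing_code ?x (lift n \<pi>) = card ?L"
    unfolding crossing_code_def before_lift[OF sp assms(2)] changes_card by simp
  also have "\<dots> = inv_code n \<pi> i"
  proof (cases "even n")
    case True
    then obtain m where m: "n = 2 * m" by blast
    have half: "n div 2 = m" using m by simp
    let ?K = "{k. 1 \<le> k \<and> k \<le> n div 2 \<and> i < 2*k - 1 \<and> ent \<pi> (2*k) < ?x \<and> ?x < ent \<pi> (2*k - 1)}"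
    have "bij_betw (\<lambda>l. n div 2 - l) ?L ?K"
    proof (rule bij_betw_byWitness[where f' = "\<lambda>k. n div 2 - k"])
      show "(\<lambda>l. n div 2 - l) ` ?L \<subseteq> ?K"
      proof
        fix k assume "k \<in> (\<lambda>l. n div 2 - l) ` ?L"
        then obtain l where l: "l \<in> ?L" "k = n div 2 - l" by blast
        then have b: "2 * l + 1 < n - i" using L by blast
        then have k: "n - 2 * l = 2 * k" "n - (2 * l + 1) = 2 * k - 1" "1 \<le> k" "i < 2 * k - 1" "2 * k \<le> n"
          using l(2) m unfolding half by arith+
        have "(?x < ent \<pi> (2 * k)) \<noteq> (?x < ent \<pi> (2 * k - 1))"
          using l(1) unfolding L mem_Collect_eq k(1,2) by blast
        moreover have "ent \<pi> (2 * k - 1) > ent \<pi> (2 * k)" using alt[of "2 * k - 1"] k by auto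
        moreover have "ent \<pi> (2 * k) \<noteq> ?x" "ent \<pi> (2 * k - 1) \<noteq> ?x" "k \<le> n div 2"
          using ne[of "2 * k"] ne[of "2 * k - 1"] k by auto
        ultimately show "k \<in> ?K" using k by auto
      qed
      show "(\<lambda>k. n div 2 - k) ` ?K \<subseteq> ?L"
      proof
        fix l assume "l \<in> (\<lambda>k. n div 2 - k) ` ?K"
        then obtain k where k: "k \<in> ?K" "l = n div 2 - k" by blast
        then have "k \<le> m" "i < 2 * k - 1" by (auto simp: half)
        then have "n - 2 * l = 2 * k" "n - (2 * l + 1) = 2 * k - 1" "2 * l + 1 < n - i"
          using k(2) m unfolding half by arith+
        then show "l \<in> ?L" using k(1) unfolding L mem_Collect_eq by simp
      qed
      show "\<forall>l\<in>?L. n div 2 - (n div 2 - l) = l" unfolding L half using m by auto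
      show "\<forall>k\<in>?K. n div 2 - (n div 2 - k) = k" by auto
    qed
    then show ?thesis using True by (simp add: inv_code_def bij_betw_same_card)
  next
    case False
    then obtain m where m: "n = 2 * m + 1" by (blast elim: oddE)
    have half: "n div 2 = m" "(n - 1) div 2 = m" using m by auto
    let ?K = "{k. 1 \<le> k \<and> k \<le> (n - 1) div 2 \<and> i < 2*k \<and> ent \<pi> (2*k) < ?x \<and> ?x < ent \<pi> (2*k + 1)}"
    have "bij_betw (\<lambda>l. n div 2 - l) ?L ?K"
    proof (rule bij_betw_byWitness[where f' = "\<lambda>k. n div 2 - k"])
      show "(\<lambda>l. n div 2 - l) ` ?L \<subseteq> ?K"
      proof
        fix k assume "k \<in> (\<lambda>l. n div 2 - l) ` ?L"
        then obtain l where l: "l \<in> ?L" "k = n div 2 - l" by blast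
        then have b: "2 * l + 1 < n - i" using L by blast
        then have k: "n - 2 * l = 2 * k + 1" "n - (2 * l + 1) = 2 * k" "i < 2 * k" "2 * k < n"
          using l(2) m unfolding half by arith+
        have "(?x < ent \<pi> (2 * k + 1)) \<noteq> (?x < ent \<pi> (2 * k))"
          using l(1) unfolding L mem_Collect_eq k(1,2) by blast
        moreover have "ent \<pi> (2 * k + 1) > ent \<pi> (2 * k)" using alt[of "2 * k"] k by auto
        moreover have "ent \<pi> (2 * k) \<noteq> ?x" "ent \<pi> (2 * k + 1) \<noteq> ?x" "k \<le> (n - 1) div 2"
          using ne[of "2 * k"] ne[of "2 * k + 1"] k by auto
        ultimately show "k \<in> ?K" using k by auto
      qed
      show "(\<lambda>k. n div 2 - k) ` ?K \<subseteq> ?L"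
      proof
        fix l assume "l \<in> (\<lambda>k. n div 2 - k) ` ?K"
        then obtain k where k: "k \<in> ?K" "l = n div 2 - k" by blast
        then have "k \<le> m" "i < 2 * k" unfolding half by auto
        then have "n - 2 * l = 2 * k + 1" "n - (2 * l + 1) = 2 * k" "2 * l + 1 < n - i"
          using k(2) m unfolding half by arith+
        then show "l \<in> ?L" using k(1) unfolding L mem_Collect_eq by simp
      qed
      show "\<forall>l\<in>?L. n div 2 - (n div 2 - l) = l" unfolding L half using m by auto
      show "\<forall>k\<in>?K. n div 2 - (n div 2 - k) = k" unfolding half by auto
    qed
    then show ?thesis using False by (simp add: inv_code_def bij_betw_same_card)
  qed
  finally show ?thesis .
qed

section \<open>Path heights and labeled ballot paths\<close>

lemma ypos_0 [simp]: "ypos P 0 = 0"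
  by (simp add: ypos_def)

lemma ypos_Cons: "ypos (p # P) (Suc k) = (if p then 1 else - 1) + ypos P k"
  unfolding ypos_def by (subst sum.lessThan_Suc_shift) simp

lemma height_take: "height (take k P) k = height P k"
proof -
  have "ypos (take k P) j = ypos P j" if "j \<le> k" for j
    unfolding ypos_def using that by (intro sum.cong) auto
  then show ?thesis by (simp add: height_def)
qed

lemma length_encode [simp]: "length (encode e y v s) = v"
  by (induction v arbitrary: y) (auto simp: Let_def)

text \<open>\<open>height\<close> measures along a path starting at 0 while the recursion starts at
  \<open>y\<close>, hence the summand \<open>y\<close>.\<close>

lemma encode_nth:
  assumes "k < v" "P = map fst (encode e y v s)" "x = signed_entry (int (v - k)) s"
  shows "encode e y v s ! k = (upward e x s,
    if 0 < x then int (crossing_code x s) else y + height P (Suc k) - int (crossing_code x s))"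
  using assms
proof (induction v arbitrary: y k P)
  case (Suc v)
  define x0 where "x0 = signed_entry (int (Suc v)) s"
  define p where "p = upward e x0 s"
  define y' where "y' = (if p then y + 1 else y - 1)"
  define P' where "P' = map fst (encode e y' v s)"
  have enc: "encode e y (Suc v) s = (p, if 0 < x0 then int (crossing_code x0 s)
      else min y y' - int (crossing_code x0 s)) # encode e y' v s"
    by (simp add: Let_def x0_def p_def y'_def)
  have P: "P = p # P'" using Suc.prems(2) unfolding enc P'_def by simp
  show ?case
  proof (cases k)
    case 0
    have "y + height P (Suc 0) = min y y'"
      by (auto simp: P height_def ypos_Cons y'_def)
    then show ?thesis using 0 Suc.prems(3) by (simp add: enc x0_def p_def del: encode.simps)
  next
    case (Suc k')
    have "height P (Suc (Suc k')) = (if p then 1 else - 1) + height P' (Suc k')"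
      by (simp add: P height_def ypos_Cons)
    then have "y + height P (Suc k) = y' + height P' (Suc k')"
      using Suc by (simp add: y'_def)
    then show ?thesis
      using Suc.IH[of k' P' y'] Suc.prems Suc by (simp add: enc P'_def del: encode.simps)
  qed
qed simp

lemma labeled_steps_iff:
  "labeled_steps y q \<longleftrightarrow> (\<forall>k\<le>length q. 0 \<le> y + ypos (map fst q) k) \<and>
     (\<forall>k<length q. 0 \<le> snd (q ! k) \<and> snd (q ! k) \<le> y + height (map fst q) (Suc k))"
proof (induction q arbitrary: y)
  case (Cons a q)
  obtain p w where a: "a = (p, w)" by fastforce
  define y' where "y' = (if p then y + 1 else y - 1)"
  \<comment> \<open>The implied condition \<open>0 \<le> y\<close> is made explicit to supply the
    case \<open>k = 0\<close> of the ballot condition.\<close>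
  have "labeled_steps y (a # q) \<longleftrightarrow> 0 \<le> y \<and> 0 \<le> w \<and> w \<le> min y y' \<and> labeled_steps y' q"
    by (auto simp: a y'_def)
  also have "\<dots> \<longleftrightarrow> (\<forall>k\<le>length (a # q). 0 \<le> y + ypos (map fst (a # q)) k) \<and>
     (\<forall>k<length (a # q). 0 \<le> snd ((a # q) ! k) \<and>
        snd ((a # q) ! k) \<le> y + height (map fst (a # q)) (Suc k))"
  proof -
    have "y + ypos (map fst (a # q)) (Suc k) = y' + ypos (map fst q) k" for k
      by (simp add: a ypos_Cons y'_def)
    moreover from this have "y + height (map fst (a # q)) (Suc (Suc k)) = y' + height (map fst q) (Suc k)"
      "y + height (map fst (a # q)) (Suc 0) = min y y'" for k
      by (auto simp: a height_def ypos_Cons y'_def)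
    ultimately show ?thesis
      unfolding Cons.IH less_Suc_eq_le[symmetric] length_Cons All_less_Suc2
      by (auto simp: a)
  qed
  finally show ?case .
qed simp

lemma labeled_ballot_path_iff:
  "labeled_ballot_path n (map fst q, map snd q) \<longleftrightarrow> length q = n \<and> labeled_steps 0 q"
proof -
  have "(\<forall>k\<in>{1..n}. Q k) \<longleftrightarrow> (\<forall>k<n. Q (Suc k))" for Q
    by (metis One_nat_def Suc_le_eq Suc_le_mono Suc_pred atLeastAtMost_iff le_0_eq not_less zero_less_Suc)
  then show ?thesis
    unfolding labeled_ballot_path_def ballot_path_def labeled_steps_iff by auto
qed

lemma unzip_bij:
  "bij_betw (\<lambda>q. (map fst q, map snd q)) {q. length q = n \<and> labeled_steps 0 q}
     {PW. labeled_ballot_path n PW}"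
proof (rule bij_betw_byWitness[where f' = "\<lambda>(P, W). zip P W"])
  have pw: "\<exists>q. PW = (map fst q, map snd q)" if "labeled_ballot_path n PW" for PW
  proof -
    obtain P W where PW: "PW = (P, W)" by fastforce
    then have "length P = length W"
      using that by (simp add: labeled_ballot_path_def ballot_path_def)
    then show ?thesis using PW by (intro exI[of _ "zip P W"]) simp
  qed
  show "\<forall>PW\<in>{PW. labeled_ballot_path n PW}.
      (map fst (case PW of (P, W) \<Rightarrow> zip P W), map snd (case PW of (P, W) \<Rightarrow> zip P W)) = PW"
    by (auto simp: labeled_ballot_path_def ballot_path_def)
  show "(\<lambda>(P, W). zip P W) ` {PW. labeled_ballot_path n PW} \<subseteq> {q. length q = n \<and> labeled_steps 0 q}"
    using pw labeled_ballot_path_iff by (fastforce simp: zip_map_fst_snd)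
qed (auto simp: zip_map_fst_snd labeled_ballot_path_iff)

text \<open>Index \<open>k\<close> of \<open>q\<close>, counted from 0, treats the value
  \<open>n - k\<close>; this is step \<open>1 + k\<close> of \<Phi>.\<close>

lemma Phi_eq_encode:
  assumes "snake n \<pi>"
  defines "q \<equiv> encode (even n) 0 n (lift n \<pi>)"
  shows "Phi n \<pi> = (map fst q, map snd q)"
proof -
  have sp: "signed_perm n \<pi>" using assms(1) by (simp add: snake_def)
  have step: "q ! k = (let i = posn \<pi> (int (n - (1 + k) + 1)) in
      (if 0 < ent \<pi> i then odd i else even i,
       if 0 < ent \<pi> i then int (inv_code n \<pi> i)
       else height (map fst q) (1 + k) - int (inv_code n \<pi> i)))" if k: "k < n" for k
  proof -
    have "int (n - k) \<in> {1..int n}" using k by auto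
    then obtain i where i: "i \<in> {1..n}" "\<bar>ent \<pi> i\<bar> = int (n - k)"
      using signed_perm_position[OF sp] by blast
    have nk: "int (n - (1 + k) + 1) = \<bar>ent \<pi> i\<bar>" using k i(2) by simp
    have x: "ent \<pi> i = signed_entry (int (n - k)) (lift n \<pi>)" using signed_entry_lift[OF sp i(1)] i(2) by simp
    show ?thesis
      unfolding nk posn_ent[OF sp i(1)] Let_def
      using encode_nth[OF k refl x, of "even n" 0] upward_lift[OF sp i(1)] crossing_code_lift[OF assms(1) i(1)]
      by (simp add: q_def)
  qed
  have len: "length q = n" by (simp add: q_def)
  have P: "Phi_path n \<pi> = map fst q"
    by (rule nth_equalityI) (auto simp: Phi_path_def len step Let_def simp del: upt_Suc)
  have "snd (Phi n \<pi>) = map snd q"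
    by (rule nth_equalityI)
      (auto simp: Phi_def P len step Let_def height_take simp del: upt_Suc)
  moreover have "fst (Phi n \<pi>) = map fst q" by (simp add: Phi_def P Let_def)
  ultimately show ?thesis by (metis prod.collapse)
qed

theorem theorem3p1:
  fixes n :: nat
  assumes "n \<ge> 1"
  shows "(\<forall>\<pi>. snake n \<pi> \<longrightarrow> labeled_ballot_path n (Phi n \<pi>)) \<and>
         bij_betw (Phi n) {\<pi>. snake n \<pi>} {PW. labeled_ballot_path n PW}"
proof -
  \<comment> \<open>A lifted snake has the single limit entry of absolute value
    \<open>n + 1\<close>, so \<open>t = 1\<close> and the path starts at height 0.\<close>
  have "bij_betw (encode (even n) 0 n) {s. word_state (int n + 1) (even n) n 1 s}
      {q. length q = n \<and> labeled_steps 0 q}"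
    using encode_bij[of n "int n + 1" "even n" 1] by simp
  from bij_betw_trans[OF lift_bij[OF assms] bij_betw_trans[OF this unzip_bij]]
  have "bij_betw (Phi n) {\<pi>. snake n \<pi>} {PW. labeled_ballot_path n PW}"
    by (rule bij_betw_cong[THEN iffD1, rotated]) (simp add: Phi_eq_encode)
  then show ?thesis using bij_betwE by blast
qed

end
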